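(* Let $R$ be a reduced commutative ring with identity. Then $\chi(\mathbb{AG}(R))=cl(\mathbb{AG}(R))$. Moreover, if $\chi(\mathbb{AG}(R))$ is finite, then $R$ has a finite number of minimal primes, and if $n$ is this number and $R$ is not an integral domain, then $$\chi(\mathbb{AG}(R))=cl(\mathbb{AG}(R))=n.$$
   Context: An ideal $I$ of $R$ is an annihilating-ideal if $\mathrm{Ann}(I)\neq(0)$, i.e. there is a nonzero ideal $J$ of $R$ with $IJ=(0)$. The annihilating-ideal graph $\mathbb{AG}(R)$ is the undirected simple graph whose vertices are the nonzero annihilating-ideals of $R$, where two distinct vertices $I,J$ are adjacent if and only if $IJ=(0)$. For a graph $G$, $\chi(G)$ is the chromatic number and $cl(G)$ is the clique number (number of vertices in a largest complete subgraph); both take values in $\{0,1,2,\dots\}\cup\{\infty\}$, the value being $\infty$ when it is not finite. *)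

theory Defs
  imports "HOL-Algebra.Ideal_Product" "HOL-Library.Extended_Nat" "HOL-Library.Ramsey"
begin

section \<open>Clique number and chromatic number\<close>

text \<open>
  A simple graph is given by a vertex set \<open>V\<close> and a set \<open>E\<close> of two-element sets of vertices;
  \<^const>\<open>clique\<close> is the predicate from \<^theory>\<open>HOL-Library.Ramsey\<close>. Both numbers live in
  \<^typ>\<open>enat\<close>. The clique number is \<open>\<infinity>\<close> as soon as there are finite cliques of
  unbounded size, in particular if there is an infinite clique. The infimum of the empty set is
  \<open>\<infinity>\<close>, so the chromatic number is \<open>\<infinity>\<close> if no finite number of colours suffices.
\<close>

definition clique_number :: "'v set \<Rightarrow> 'v set set \<Rightarrow> enat" where
  "clique_number V E = Sup {enat (card K) | K. K \<subseteq> V \<and> finite K \<and> clique K E}"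

definition proper_colouring :: "'v set \<Rightarrow> 'v set set \<Rightarrow> nat \<Rightarrow> ('v \<Rightarrow> nat) \<Rightarrow> bool" where
  "proper_colouring V E k f \<longleftrightarrow>
     f ` V \<subseteq> {..<k} \<and> (\<forall>v\<in>V. \<forall>w\<in>V. {v, w} \<in> E \<longrightarrow> f v \<noteq> f w)"

definition chromatic_number :: "'v set \<Rightarrow> 'v set set \<Rightarrow> enat" where
  "chromatic_number V E = Inf {enat k | k. \<exists>f. proper_colouring V E k f}"

section \<open>Reduced rings and minimal primes\<close>

definition reduced_ring :: "('a, 'b) ring_scheme \<Rightarrow> bool" where
  "reduced_ring R \<longleftrightarrow>
     (\<forall>x\<in>carrier R. \<forall>n::nat. x [^]\<^bsub>R\<^esub> n = \<zero>\<^bsub>R\<^esub> \<longrightarrow> x = \<zero>\<^bsub>R\<^esub>)"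

definition minimal_primes :: "('a, 'b) ring_scheme \<Rightarrow> 'a set set" where
  "minimal_primes R = {P. primeideal P R \<and> (\<forall>Q. primeideal Q R \<and> Q \<subseteq> P \<longrightarrow> Q = P)}"

section \<open>The annihilating-ideal graph\<close>

definition annihilator :: "('a, 'b) ring_scheme \<Rightarrow> 'a set \<Rightarrow> 'a set" where
  "annihilator R I = {r \<in> carrier R. \<forall>x\<in>I. r \<otimes>\<^bsub>R\<^esub> x = \<zero>\<^bsub>R\<^esub>}"

definition annihilating_ideal :: "('a, 'b) ring_scheme \<Rightarrow> 'a set \<Rightarrow> bool" where
  "annihilating_ideal R I \<longleftrightarrow> ideal I R \<and> annihilator R I \<noteq> {\<zero>\<^bsub>R\<^esub>}"

definition AG_verts :: "('a, 'b) ring_scheme \<Rightarrow> 'a set set" where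
  "AG_verts R = {I. annihilating_ideal R I \<and> I \<noteq> {\<zero>\<^bsub>R\<^esub>}}"

definition AG_edges :: "('a, 'b) ring_scheme \<Rightarrow> 'a set set set" where
  "AG_edges R = {{I, J} | I J. I \<in> AG_verts R \<and> J \<in> AG_verts R \<and> I \<noteq> J \<and>
                               I \<cdot>\<^bsub>R\<^esub> J = {\<zero>\<^bsub>R\<^esub>}}"

text \<open>The two descriptions of annihilating-ideals, via \<open>Ann\<close> and via ideal products, agree.\<close>

lemma (in cring) annihilating_ideal_iff_ideal_prod:
  assumes "ideal I R"
  shows "annihilating_ideal R I \<longleftrightarrow> (\<exists>J. ideal J R \<and> J \<noteq> {\<zero>} \<and> I \<cdot> J = {\<zero>})"
proof
  assume L: "annihilating_ideal R I"
  have car: "\<And>x. x \<in> I \<Longrightarrow> x \<in> carrier R" by (rule ideal.Icarr[OF assms])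
  have z: "\<zero> \<in> annihilator R I" using car by (auto simp: annihilator_def)
  with L obtain r where r: "r \<in> annihilator R I" "r \<noteq> \<zero>"
    by (auto simp: annihilating_ideal_def)
  then have rc: "r \<in> carrier R" by (simp add: annihilator_def)
  have id: "ideal (PIdl r) R" by (rule cgenideal_ideal[OF rc])
  have ne: "PIdl r \<noteq> {\<zero>}" using cgenideal_self[OF rc] r(2) by auto
  have "s = \<zero>" if "s \<in> I \<cdot> (PIdl r)" for s
    using that
  proof (induction s rule: ideal_prod.induct)
    case (prod i j)
    then obtain c where c: "c \<in> carrier R" "j = c \<otimes> r" by (auto simp: cgenideal_def)
    have "i \<otimes> j = c \<otimes> (r \<otimes> i)" using c rc car[OF prod(1)] by (simp add: m_ac)
    also have "\<dots> = \<zero>" using r(1) prod(1) c(1) by (simp add: annihilator_def)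
    finally show ?case .
  qed simp
  moreover have "\<zero> \<in> I \<cdot> (PIdl r)"
    using ideal_prod_is_ideal[OF assms id]
    by (simp add: additive_subgroup.zero_closed ideal.axioms(1))
  ultimately have "I \<cdot> (PIdl r) = {\<zero>}" by blast
  with id ne show "\<exists>J. ideal J R \<and> J \<noteq> {\<zero>} \<and> I \<cdot> J = {\<zero>}" by blast
next
  assume "\<exists>J. ideal J R \<and> J \<noteq> {\<zero>} \<and> I \<cdot> J = {\<zero>}"
  then obtain J where J: "ideal J R" "J \<noteq> {\<zero>}" "I \<cdot> J = {\<zero>}" by blast
  have "\<zero> \<in> J" using J(1) by (simp add: additive_subgroup.zero_closed ideal.axioms(1))
  with J(2) obtain j where j: "j \<in> J" "j \<noteq> \<zero>" by blast
  have jc: "j \<in> carrier R" by (rule ideal.Icarr[OF J(1) j(1)])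
  have "j \<otimes> x = \<zero>" if "x \<in> I" for x
    using ideal_prod.prod[OF that j(1), of R] J(3) m_comm[OF jc ideal.Icarr[OF assms that]] by simp
  with jc have "j \<in> annihilator R I" by (simp add: annihilator_def)
  with j(2) assms show "annihilating_ideal R I" by (auto simp: annihilating_ideal_def)
qed

end

theory Submission
  imports Defs
begin

text \<open>
  Everything is read off from a largest set \<open>X\<close> of nonzero, pairwise orthogonal elements, that is,
  elements with \<open>x y = 0\<close> for \<open>x \<noteq> y\<close>. In a reduced ring orthogonal nonzero elements generate
  different ideals, so an orthogonal set with at least two elements is a clique of principal ideals
  of the same size (\<open>card_orthogonal_le_clique_number\<close>). Hence \<open>X\<close> exists as soon as the clique
  number is finite.

  Maximality of \<open>X\<close> has two consequences. The ideals \<open>Ann x\<close>, \<open>x \<in> X\<close>, are prime: if \<open>a b x = 0\<close>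
  but \<open>a x\<close> and \<open>b x\<close> are nonzero, then replacing \<open>x\<close> by \<open>a x\<close> and \<open>b x\<close> gives a larger orthogonal
  set. And they intersect in \<open>0\<close>: a nonzero element of the intersection could be added to \<open>X\<close>.
  Therefore they are exactly the minimal primes (\<open>minimal_primes_eq_annihilators\<close>), and they are
  pairwise different, so there are \<open>card X\<close> of them. They also colour the graph: a nonzero ideal
  fails to lie in some \<open>Ann x\<close>, and if neither of two ideals lies in a given prime, then their product is
  not \<open>0\<close> (\<open>chromatic_number_le_card\<close>). If \<open>R\<close> is not a domain, then \<open>X\<close> is not a singleton
  \<open>{x}\<close>, because \<open>Ann x\<close> would be both prime and \<open>0\<close>; therefore

    \<open>cl \<le> \<chi> \<le> card X \<le> cl\<close>.

  Over a domain the graph has no vertices, and both numbers are \<open>0\<close>. If the clique number is infinite,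
  so is the chromatic number, because \<open>cl \<le> \<chi>\<close> in every graph.
\<close>

section \<open>Clique number and chromatic number of a graph\<close>

lemma card_clique_le_clique_number:
  assumes "K \<subseteq> V" "finite K" "clique K E"
  shows "enat (card K) \<le> clique_number V E"
  unfolding clique_number_def using assms by (intro Sup_upper) auto

lemma chromatic_number_le_of_colouring:
  assumes "proper_colouring V E k f"
  shows "chromatic_number V E \<le> enat k"
  unfolding chromatic_number_def using assms by (intro Inf_lower) auto

text \<open>A proper colouring is injective on every clique.\<close>

lemma clique_number_le_chromatic_number: "clique_number V E \<le> chromatic_number V E"
  unfolding clique_number_def chromatic_number_def
proof (intro Sup_least Inf_greatest, clarify)
  fix K k f
  assume K: "K \<subseteq> V" "finite K" "clique K E" and f: "proper_colouring V E k f"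
  have "inj_on f K"
    using K f unfolding inj_on_def clique_def proper_colouring_def by blast
  moreover have "f ` K \<subseteq> {..<k}"
    using K f unfolding proper_colouring_def by blast
  ultimately show "enat (card K) \<le> enat k"
    using card_inj_on_le[of f K "{..<k}"] by simp
qed

section \<open>Orthogonal sets in a reduced ring\<close>

lemma (in cring) ideal_prod_eq_zero_iff:
  assumes "ideal I R" "ideal J R"
  shows "I \<cdot> J = {\<zero>} \<longleftrightarrow> (\<forall>a\<in>I. \<forall>b\<in>J. a \<otimes> b = \<zero>)"
proof
  assume "I \<cdot> J = {\<zero>}"
  then show "\<forall>a\<in>I. \<forall>b\<in>J. a \<otimes> b = \<zero>"
    using ideal_prod.prod[of _ I _ J R] by blast
next
  assume *: "\<forall>a\<in>I. \<forall>b\<in>J. a \<otimes> b = \<zero>"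
  have "s = \<zero>" if "s \<in> I \<cdot> J" for s
    using that by (induction s rule: ideal_prod.induct) (use * in auto)
  moreover have "\<zero> \<in> I \<cdot> J"
    using ideal_prod_is_ideal[OF assms]
    by (simp add: additive_subgroup.zero_closed ideal.axioms(1))
  ultimately show "I \<cdot> J = {\<zero>}" by blast
qed

definition orthogonal_set :: "('a, 'b) ring_scheme \<Rightarrow> 'a set \<Rightarrow> bool" where
  "orthogonal_set R X \<longleftrightarrow> finite X \<and> X \<subseteq> carrier R - {\<zero>\<^bsub>R\<^esub>} \<and>
     (\<forall>x\<in>X. \<forall>y\<in>X. x \<noteq> y \<longrightarrow> x \<otimes>\<^bsub>R\<^esub> y = \<zero>\<^bsub>R\<^esub>)"

definition maximum_orthogonal_set :: "('a, 'b) ring_scheme \<Rightarrow> 'a set \<Rightarrow> bool" where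
  "maximum_orthogonal_set R X \<longleftrightarrow>
     orthogonal_set R X \<and> (\<forall>Y. orthogonal_set R Y \<longrightarrow> card Y \<le> card X)"

locale reduced_cring = cring +
  assumes reduced: "reduced_ring R"
begin

lemma square_eq_zero:
  assumes "x \<in> carrier R" "x \<otimes> x = \<zero>"
  shows "x = \<zero>"
proof -
  have "x [^] (Suc (Suc 0)) = \<zero>" using assms by simp
  with reduced assms(1) show ?thesis unfolding reduced_ring_def by blast
qed

text \<open>
  The clique consists of the principal ideals of the elements. They are pairwise different: an
  ideal generated by two orthogonal elements alike would have square \<open>0\<close>.
\<close>

lemma card_orthogonal_le_clique_number:
  assumes X: "orthogonal_set R X" and two: "2 \<le> card X"
  shows "enat (card X) \<le> clique_number (AG_verts R) (AG_edges R)"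
proof -
  have car: "x \<in> carrier R" "x \<noteq> \<zero>" if "x \<in> X" for x
    using X that by (auto simp: orthogonal_set_def)
  have orth: "x \<otimes> y = \<zero>" if "x \<in> X" "y \<in> X" "x \<noteq> y" for x y
    using X that by (auto simp: orthogonal_set_def)
  have fin: "finite X" using X by (simp add: orthogonal_set_def)
  have prod0: "(PIdl x) \<cdot> (PIdl y) = {\<zero>}" if xy: "x \<in> X" "y \<in> X" "x \<noteq> y" for x y
  proof -
    have "(c \<otimes> x) \<otimes> (d \<otimes> y) = \<zero>" if "c \<in> carrier R" "d \<in> carrier R" for c d
    proof -
      have "(c \<otimes> x) \<otimes> (d \<otimes> y) = (c \<otimes> d) \<otimes> (x \<otimes> y)"
        using car(1) xy that by (simp add: m_ac)
      then show ?thesis using orth[OF xy] that by simp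
    qed
    then show ?thesis
      using ideal_prod_eq_zero_iff[OF cgenideal_ideal cgenideal_ideal] car(1) xy
      by (auto simp: cgenideal_def)
  qed
  have ne: "PIdl x \<noteq> {\<zero>}" if "x \<in> X" for x
    using cgenideal_self[of x] car[OF that] by auto
  have inj: "inj_on (\<lambda>x. PIdl x) X"
  proof (rule inj_onI, rule ccontr)
    fix x y assume xy: "x \<in> X" "y \<in> X" "PIdl x = PIdl y" "x \<noteq> y"
    have "x \<in> PIdl y" using cgenideal_self[of x] car xy by auto
    then have "x \<otimes> x \<in> (PIdl x) \<cdot> (PIdl y)"
      using ideal_prod.prod[of x "PIdl x" x "PIdl y" R] xy(3) by simp
    then have "x \<otimes> x = \<zero>" using prod0[OF xy(1,2,4)] by simp
    then show False using square_eq_zero car xy by blast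
  qed
  have vert: "PIdl x \<in> AG_verts R" if x: "x \<in> X" for x
  proof -
    \<comment> \<open>A second element of \<open>X\<close> is what makes \<open>x\<close> a zero divisor.\<close>
    have "X \<noteq> {x}" using two by auto
    then obtain y where "y \<in> X" "y \<noteq> x" using x by blast
    then show ?thesis
      unfolding AG_verts_def using x ne prod0[of x y] car(1) cgenideal_ideal
        annihilating_ideal_iff_ideal_prod[of "PIdl x"] by blast
  qed
  have "{PIdl x, PIdl y} \<in> AG_edges R" if "x \<in> X" "y \<in> X" "PIdl x \<noteq> PIdl y" for x y
  proof -
    have "x \<noteq> y" using that(3) by blast
    then show ?thesis
      unfolding AG_edges_def mem_Collect_eq
      using vert[OF that(1)] vert[OF that(2)] prod0[OF that(1,2)] that(3)
      by (intro exI[of _ "PIdl x"] exI[of _ "PIdl y"] conjI refl)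
  qed
  then have "clique ((\<lambda>x. PIdl x) ` X) (AG_edges R)"
    unfolding clique_def by auto
  then have "enat (card ((\<lambda>x. PIdl x) ` X)) \<le> clique_number (AG_verts R) (AG_edges R)"
    using vert fin by (intro card_clique_le_clique_number) auto
  then show ?thesis using card_image[OF inj] by simp
qed

lemma ex_maximum_orthogonal_set:
  assumes "clique_number (AG_verts R) (AG_edges R) \<noteq> \<infinity>"
  obtains X where "maximum_orthogonal_set R X"
proof -
  obtain m where m: "clique_number (AG_verts R) (AG_edges R) = enat m"
    using assms by auto
  \<comment> \<open>A single nonzero element need not give a vertex of the graph, so \<open>m\<close> itself may be too
    small: over a domain \<open>m = 0\<close>, but \<open>{\<one>}\<close> is orthogonal.\<close>
  have bound: "card Y \<le> Suc m" if "orthogonal_set R Y" for Y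
    using card_orthogonal_le_clique_number[OF that] m by (cases "2 \<le> card Y") auto
  have "orthogonal_set R {}" by (simp add: orthogonal_set_def)
  then have "\<exists>X. orthogonal_set R X \<and> (\<forall>Y. orthogonal_set R Y \<longrightarrow> card Y \<le> card X)"
    using bound by (intro ex_has_greatest_nat[where b = "Suc (Suc m)"]) (auto simp: less_Suc_eq_le)
  then show thesis using that by (auto simp: maximum_orthogonal_set_def)
qed

section \<open>Annihilators of the elements of a largest orthogonal set\<close>

context
  fixes X
  assumes X: "maximum_orthogonal_set R X"
begin

lemma finite_X: "finite X"
  and X_carrier: "x \<in> X \<Longrightarrow> x \<in> carrier R"
  and X_nonzero: "x \<in> X \<Longrightarrow> x \<noteq> \<zero>"
  and X_orthogonal: "x \<in> X \<Longrightarrow> y \<in> X \<Longrightarrow> x \<noteq> y \<Longrightarrow> x \<otimes> y = \<zero>"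
  and X_maximum: "orthogonal_set R Y \<Longrightarrow> card Y \<le> card X"
  using X by (auto simp: maximum_orthogonal_set_def orthogonal_set_def)

lemma eq_zero_if_annihilates_X:
  assumes y: "y \<in> carrier R" and ann: "\<And>x. x \<in> X \<Longrightarrow> y \<otimes> x = \<zero>"
  shows "y = \<zero>"
proof (rule ccontr)
  assume "y \<noteq> \<zero>"
  \<comment> \<open>Otherwise \<open>y\<close> would annihilate itself.\<close>
  have "y \<notin> X" using ann square_eq_zero y \<open>y \<noteq> \<zero>\<close> by blast
  moreover have "x \<otimes> y = \<zero>" if "x \<in> X" for x
    using ann[OF that] m_comm[OF y X_carrier[OF that]] by simp
  then have "orthogonal_set R (insert y X)"
    using finite_X X_carrier X_nonzero X_orthogonal y ann \<open>y \<noteq> \<zero>\<close>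
    unfolding orthogonal_set_def by auto
  ultimately show False using X_maximum[of "insert y X"] finite_X by simp
qed

text \<open>
  This is the primality of \<open>Ann x\<close>: otherwise \<open>x\<close> could be traded for the two elements \<open>a x\<close> and
  \<open>b x\<close>, which are orthogonal to each other and to the rest of \<open>X\<close>.
\<close>

lemma annihilates_factor:
  assumes x: "x \<in> X" and a: "a \<in> carrier R" and b: "b \<in> carrier R"
    and ab: "(a \<otimes> b) \<otimes> x = \<zero>"
  shows "a \<otimes> x = \<zero> \<or> b \<otimes> x = \<zero>"
proof (rule ccontr)
  assume "\<not> ?thesis"
  then have nz: "a \<otimes> x \<noteq> \<zero>" "b \<otimes> x \<noteq> \<zero>" by auto
  let ?Z = "X - {x}"
  let ?Y = "insert (a \<otimes> x) (insert (b \<otimes> x) ?Z)"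
  have xc: "x \<in> carrier R" by (rule X_carrier[OF x])
  have "(a \<otimes> x) \<otimes> (b \<otimes> x) = ((a \<otimes> b) \<otimes> x) \<otimes> x"
    using a b xc by (simp add: m_ac)
  then have abx: "(a \<otimes> x) \<otimes> (b \<otimes> x) = \<zero>" using ab xc by simp
  then have bax: "(b \<otimes> x) \<otimes> (a \<otimes> x) = \<zero>" using a b xc by (simp add: m_comm)
  have other: "(c \<otimes> x) \<otimes> z = \<zero>" "z \<otimes> (c \<otimes> x) = \<zero>"
    if "z \<in> ?Z" "c \<in> carrier R" for z c
  proof -
    have z: "z \<in> carrier R" "x \<otimes> z = \<zero>" using that X_carrier X_orthogonal x by auto
    show "(c \<otimes> x) \<otimes> z = \<zero>" using that z xc by (simp add: m_assoc)
    then show "z \<otimes> (c \<otimes> x) = \<zero>" using that z xc by (simp add: m_comm)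
  qed
  have ne: "a \<otimes> x \<noteq> b \<otimes> x"
    using abx nz square_eq_zero[of "a \<otimes> x"] a xc by auto
  have new: "c \<otimes> x \<notin> ?Z" if "c \<in> carrier R" "c \<otimes> x \<noteq> \<zero>" for c
    using other[of "c \<otimes> x" c] square_eq_zero[of "c \<otimes> x"] that xc by auto
  have "orthogonal_set R ?Y"
    unfolding orthogonal_set_def
    using finite_X X_carrier X_nonzero X_orthogonal other abx bax nz a b xc by auto
  then have "card ?Y \<le> card X" by (rule X_maximum)
  moreover have "card ?Y = Suc (card X)"
    using new a b nz ne finite_X x by (simp add: card.remove[of X x] del: card_Diff_insert)
  ultimately show False by simp
qed

lemma primeideal_annihilator:
  assumes x: "x \<in> X"
  shows "primeideal (annihilator R {x}) R"
proof (rule primeidealI)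
  have xc: "x \<in> carrier R" by (rule X_carrier[OF x])
  show "ideal (annihilator R {x}) R"
  proof (rule idealI[OF ring_axioms])
    show "subgroup (annihilator R {x}) (add_monoid R)"
      using xc by (intro add.subgroupI) (auto simp: annihilator_def l_distr l_minus)
  next
    fix a c assume "a \<in> annihilator R {x}" and c: "c \<in> carrier R"
    then have a: "a \<in> carrier R" "a \<otimes> x = \<zero>" by (auto simp: annihilator_def)
    then show "c \<otimes> a \<in> annihilator R {x}"
      using c xc by (simp add: annihilator_def m_assoc)
    then show "a \<otimes> c \<in> annihilator R {x}" using a c by (simp add: m_comm)
  qed
  show "cring R" by (rule is_cring)
  have "\<one> \<notin> annihilator R {x}" using X_nonzero[OF x] xc by (simp add: annihilator_def)
  then show "carrier R \<noteq> annihilator R {x}" by blast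
  show "a \<in> annihilator R {x} \<or> b \<in> annihilator R {x}"
    if "a \<in> carrier R" "b \<in> carrier R" "a \<otimes> b \<in> annihilator R {x}" for a b
    using annihilates_factor[OF x, of a b] that by (auto simp: annihilator_def)
qed

lemma annihilator_subset_prime:
  assumes Q: "primeideal Q R" and x: "x \<in> carrier R" "x \<notin> Q"
  shows "annihilator R {x} \<subseteq> Q"
proof
  fix y assume "y \<in> annihilator R {x}"
  then have y: "y \<in> carrier R" "y \<otimes> x = \<zero>" by (auto simp: annihilator_def)
  have "\<zero> \<in> Q"
    using Q by (simp add: additive_subgroup.zero_closed ideal.axioms(1) primeideal.axioms(1))
  then show "y \<in> Q" using primeideal.I_prime[OF Q y(1) x(1)] y(2) x(2) by auto
qed

text \<open>
  Otherwise a product of elements, one from each \<open>Ann x\<close> and outside \<open>Q\<close>, would lie outside \<open>Q\<close>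
  but annihilate all of \<open>X\<close>, hence be \<open>0\<close>.
\<close>

lemma prime_contains_annihilator:
  assumes Q: "primeideal Q R"
  obtains x where "x \<in> X" "annihilator R {x} \<subseteq> Q"
proof (rule ccontr)
  assume "\<not> thesis"
  then have no: "\<not> annihilator R {x} \<subseteq> Q" if "x \<in> X" for x
    using that \<open>\<And>x. x \<in> X \<Longrightarrow> annihilator R {x} \<subseteq> Q \<Longrightarrow> thesis\<close> by blast
  have id: "ideal Q R" using Q by (rule primeideal.axioms(1))
  have zero: "\<zero> \<in> Q"
    using id by (simp add: additive_subgroup.zero_closed ideal.axioms(1))
  have "\<exists>y\<in>carrier R - Q. \<forall>x\<in>S. y \<otimes> x = \<zero>" if "finite S" "S \<subseteq> X" for S
    using that
  proof (induction S rule: finite_induct)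
    case empty
    have "\<one> \<notin> Q"
      using ideal.one_imp_carrier[OF id] primeideal.I_notcarr[OF Q] by auto
    then show ?case by blast
  next
    case (insert x S)
    then obtain y where y: "y \<in> carrier R" "y \<notin> Q" "\<forall>z\<in>S. y \<otimes> z = \<zero>" by auto
    obtain p where p: "p \<in> carrier R" "p \<otimes> x = \<zero>" "p \<notin> Q"
      using no[of x] insert.prems by (auto simp: annihilator_def)
    have xc: "x \<in> carrier R" and Sc: "\<And>z. z \<in> S \<Longrightarrow> z \<in> carrier R"
      using insert.prems X_carrier by auto
    have "y \<otimes> p \<notin> Q" using primeideal.I_prime[OF Q] y p by blast
    moreover have "(y \<otimes> p) \<otimes> x = \<zero>" using y p xc by (simp add: m_assoc)
    moreover have "(y \<otimes> p) \<otimes> z = \<zero>" if "z \<in> S" for z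
    proof -
      have "(y \<otimes> p) \<otimes> z = p \<otimes> (y \<otimes> z)" using y p Sc[OF that] by (simp add: m_ac)
      then show ?thesis using y p that by simp
    qed
    ultimately show ?case using y p by auto
  qed
  from this[OF finite_X subset_refl]
  obtain y where y: "y \<in> carrier R" "y \<notin> Q" "\<forall>x\<in>X. y \<otimes> x = \<zero>" by auto
  have "y = \<zero>" by (rule eq_zero_if_annihilates_X) (use y in auto)
  then show False using y(2) zero by simp
qed

lemma not_in_own_annihilator: "x \<in> X \<Longrightarrow> x \<notin> annihilator R {x}"
  using square_eq_zero[of x] X_carrier[of x] X_nonzero[of x] by (auto simp: annihilator_def)

lemma minimal_primes_eq_annihilators:
  "minimal_primes R = (\<lambda>x. annihilator R {x}) ` X"
proof (intro equalityI subsetI)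
  fix P assume P: "P \<in> minimal_primes R"
  then have "primeideal P R" by (simp add: minimal_primes_def)
  then obtain x where "x \<in> X" "annihilator R {x} \<subseteq> P"
    by (rule prime_contains_annihilator)
  then show "P \<in> (\<lambda>x. annihilator R {x}) ` X"
    using P primeideal_annihilator unfolding minimal_primes_def by blast
next
  fix P assume "P \<in> (\<lambda>x. annihilator R {x}) ` X"
  then obtain x where x: "x \<in> X" "P = annihilator R {x}" by blast
  \<comment> \<open>A prime inside \<open>Ann x\<close> misses \<open>x\<close>, and a prime that misses \<open>x\<close> contains \<open>Ann x\<close>.\<close>
  have "Q = P" if "primeideal Q R" "Q \<subseteq> P" for Q
    using annihilator_subset_prime[OF that(1) X_carrier[OF x(1)]]
      not_in_own_annihilator[OF x(1)] that x(2) by blast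
  then show "P \<in> minimal_primes R"
    using primeideal_annihilator[OF x(1)] x(2) by (simp add: minimal_primes_def)
qed

lemma card_minimal_primes: "card (minimal_primes R) = card X"
proof -
  have "inj_on (\<lambda>x. annihilator R {x}) X"
  proof (rule inj_onI, rule ccontr)
    fix x y
    assume xy: "x \<in> X" "y \<in> X" "annihilator R {x} = annihilator R {y}" "x \<noteq> y"
    then have "x \<in> annihilator R {y}"
      using X_orthogonal[of x y] X_carrier[of x] by (simp add: annihilator_def)
    then show False using not_in_own_annihilator[OF xy(1)] xy(3) by simp
  qed
  then show ?thesis by (simp add: minimal_primes_eq_annihilators card_image)
qed

text \<open>
  The colours are the elements of \<open>X\<close>, that is, the minimal primes: an ideal receives a minimal
  prime that does not contain it.
\<close>

lemma chromatic_number_le_card: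
  "chromatic_number (AG_verts R) (AG_edges R) \<le> enat (card X)"
proof -
  obtain h where h: "bij_betw h X {0..<card X}"
    using ex_bij_betw_finite_nat[OF finite_X] by blast
  define c where "c I = (SOME x. x \<in> X \<and> (\<exists>a\<in>I. a \<otimes> x \<noteq> \<zero>))" for I
  have c: "c I \<in> X \<and> (\<exists>a\<in>I. a \<otimes> c I \<noteq> \<zero>)" if I: "I \<in> AG_verts R" for I
  proof -
    have id: "ideal I R" and "I \<noteq> {\<zero>}"
      using I by (auto simp: AG_verts_def annihilating_ideal_def)
    moreover have "\<zero> \<in> I"
      using id by (simp add: additive_subgroup.zero_closed ideal.axioms(1))
    ultimately obtain a where a: "a \<in> I" "a \<noteq> \<zero>" by blast
    then have "\<exists>x\<in>X. a \<otimes> x \<noteq> \<zero>"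
      using eq_zero_if_annihilates_X[of a] ideal.Icarr[OF id] by auto
    then have "\<exists>x. x \<in> X \<and> (\<exists>a\<in>I. a \<otimes> x \<noteq> \<zero>)" using a by blast
    then show ?thesis unfolding c_def by (rule someI_ex)
  qed
  have proper: "h (c I) \<noteq> h (c J)"
    if IJ: "I \<in> AG_verts R" "J \<in> AG_verts R" "{I, J} \<in> AG_edges R" for I J
  proof
    assume "h (c I) = h (c J)"
    then have eq: "c I = c J"
      using h c[OF IJ(1)] c[OF IJ(2)] by (auto simp: bij_betw_def inj_on_def)
    obtain a b where ab: "a \<in> I" "b \<in> J" "a \<otimes> c I \<noteq> \<zero>" "b \<otimes> c I \<noteq> \<zero>"
      using c[OF IJ(1)] c[OF IJ(2)] eq by auto
    have id: "ideal I R" "ideal J R"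
      using IJ by (auto simp: AG_verts_def annihilating_ideal_def)
    have "I \<cdot> J = {\<zero>}"
      using IJ(3) ideal_prod_commute[OF id] by (auto simp: AG_edges_def doubleton_eq_iff)
    then have "a \<otimes> b = \<zero>" using ab ideal_prod_eq_zero_iff[OF id] by blast
    moreover have "a \<in> carrier R" "b \<in> carrier R" "c I \<in> X" "c I \<in> carrier R"
      using ab c[OF IJ(1)] X_carrier[of "c I"] ideal.Icarr[OF id(1)] ideal.Icarr[OF id(2)] by auto
    ultimately show False using annihilates_factor[of "c I" a b] ab by simp
  qed
  have "h (c I) < card X" if "I \<in> AG_verts R" for I
    using h c[OF that] bij_betwE[OF h] by auto
  then have "proper_colouring (AG_verts R) (AG_edges R) (card X) (\<lambda>I. h (c I))"
    unfolding proper_colouring_def using proper by blast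
  then show ?thesis by (rule chromatic_number_le_of_colouring)
qed

text \<open>If \<open>X = {x}\<close>, then the prime ideal \<open>Ann x\<close> is \<open>0\<close>.\<close>

lemma domain_if_card_eq_1:
  assumes "card X = 1"
  shows "domain R"
proof -
  obtain x where x: "X = {x}" using assms by (auto simp: card_1_singleton_iff)
  have "y = \<zero>" if "y \<in> annihilator R {x}" for y
    using that eq_zero_if_annihilates_X[of y] x by (auto simp: annihilator_def)
  moreover have "\<zero> \<in> annihilator R {x}"
    using X_carrier[of x] x by (simp add: annihilator_def)
  ultimately have "annihilator R {x} = {\<zero>}" by blast
  then show ?thesis
    using primeideal_annihilator[of x] x zeroprimeideal_domainI is_cring by auto
qed

lemma card_le_clique_number_if_not_domain:
  assumes "\<not> domain R"
  shows "enat (card X) \<le> clique_number (AG_verts R) (AG_edges R)"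
proof (cases "2 \<le> card X")
  case True
  then show ?thesis
    using X card_orthogonal_le_clique_number by (simp add: maximum_orthogonal_set_def)
next
  case False
  \<comment> \<open>This is the zero ring, the only ring with an empty largest orthogonal set.\<close>
  then have "card X = 0" using domain_if_card_eq_1 assms by linarith
  then show ?thesis by (simp add: zero_enat_def[symmetric])
qed

end

end

section \<open>The chromatic number of the annihilating-ideal graph\<close>

lemma (in domain) AG_verts_empty: "AG_verts R = {}"
proof (rule ccontr)
  assume "AG_verts R \<noteq> {}"
  then obtain I where id: "ideal I R" and ne: "I \<noteq> {\<zero>}" and ann: "annihilator R I \<noteq> {\<zero>}"
    by (auto simp: AG_verts_def annihilating_ideal_def)
  have "\<zero> \<in> I" using id by (simp add: additive_subgroup.zero_closed ideal.axioms(1))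
  with ne obtain a where a: "a \<in> I" "a \<noteq> \<zero>" by blast
  have car: "\<And>x. x \<in> I \<Longrightarrow> x \<in> carrier R" by (rule ideal.Icarr[OF id])
  then have "\<zero> \<in> annihilator R I" by (simp add: annihilator_def)
  with ann obtain r where r: "r \<in> annihilator R I" "r \<noteq> \<zero>" by blast
  then have "r \<in> carrier R" "r \<otimes> a = \<zero>" using a by (auto simp: annihilator_def)
  then show False using integral[of r a] car[OF a(1)] a r by blast
qed

theorem corollary2p11:
  fixes R :: "('a, 'b) ring_scheme"
  assumes "cring R" and "reduced_ring R"
  shows "chromatic_number (AG_verts R) (AG_edges R) = clique_number (AG_verts R) (AG_edges R) \<and>
         (chromatic_number (AG_verts R) (AG_edges R) \<noteq> \<infinity> \<longrightarrow>
            finite (minimal_primes R) \<and>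
            (\<not> domain R \<longrightarrow>
               chromatic_number (AG_verts R) (AG_edges R) = enat (card (minimal_primes R)) \<and>
               clique_number (AG_verts R) (AG_edges R) = enat (card (minimal_primes R))))"
proof -
  interpret reduced_cring R
    using assms by (simp add: reduced_cring_def reduced_cring_axioms_def)
  let ?chi = "chromatic_number (AG_verts R) (AG_edges R)"
  let ?cl = "clique_number (AG_verts R) (AG_edges R)"
  have le: "?cl \<le> ?chi" by (rule clique_number_le_chromatic_number)
  show ?thesis
  proof (cases "?cl = \<infinity>")
    case True
    then show ?thesis using le by simp
  next
    case False
    then obtain X where X: "maximum_orthogonal_set R X" by (rule ex_maximum_orthogonal_set)
    have fin: "finite (minimal_primes R)"
      using minimal_primes_eq_annihilators[OF X] finite_X[OF X] by simp
    show ?thesis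
    proof (cases "domain R")
      case True
      have "proper_colouring (AG_verts R) (AG_edges R) 0 f" for f
        using domain.AG_verts_empty[OF True] by (simp add: proper_colouring_def)
      then have "?chi \<le> enat 0" by (rule chromatic_number_le_of_colouring)
      then have "?chi = ?cl" using le by (simp add: zero_enat_def[symmetric])
      then show ?thesis using fin True by simp
    next
      case False
      then have "?chi = enat (card X)" "?cl = enat (card X)"
        using le chromatic_number_le_card[OF X] card_le_clique_number_if_not_domain[OF X]
        by auto
      then show ?thesis using fin card_minimal_primes[OF X] by simp
    qed
  qed
qed

end
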